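(* Let $G$ be an infinite group, let $A, B \subset G$ be subsets with $A \cap B = \varnothing$, and let $\lambda = \max\{|A|, |B|, \aleph_0\}$. If $|W_G(A,B)| > \lambda$, then $A$ and $B$ are separable in $G$. Conversely, if $W_G(A,B)$ is finite, then $A$ and $B$ are not separable in $G$.
   Context: All arguments are in ZFC. Let $G$ be an infinite group with identity $e$, and let $A, B \subset G$ be disjoint subsets. We say $A$ and $B$ are separable in $G$ if there exists a subset $X \subset G$ such that (1) $X$ is infinite; (2) $e \in X$; (3) $X = X^{-1}$, i.e. $x \in X \Rightarrow x^{-1} \in X$; (4) $XAX \cap B = \varnothing$, where $XAX = \{x a x' : x, x' \in X,\ a \in A\}$. For disjoint $A, B \subset G$ define $W_G(A,B) := \{u \in G : \{u,u^{-1}\}\, A\, \{u,u^{-1}\} \cap B = \varnothing\}$, i.e. $u \in W_G(A,B)$ if and only if the four sets $uAu$, $uAu^{-1}$, $u^{-1}Au$, $u^{-1}Au^{-1}$ are all disjoint from $B$. *)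

theory Defs
  imports "HOL-Algebra.Coset"
begin

unbundle cardinal_syntax

definition separable :: "('a, 'b) monoid_scheme \<Rightarrow> 'a set \<Rightarrow> 'a set \<Rightarrow> bool" where
  "separable G A B \<longleftrightarrow>
     (\<exists>X \<subseteq> carrier G. infinite X \<and> \<one>\<^bsub>G\<^esub> \<in> X \<and> (\<forall>x\<in>X. inv\<^bsub>G\<^esub> x \<in> X) \<and>
        (X <#>\<^bsub>G\<^esub> A <#>\<^bsub>G\<^esub> X) \<inter> B = {})"

definition W_set :: "('a, 'b) monoid_scheme \<Rightarrow> 'a set \<Rightarrow> 'a set \<Rightarrow> 'a set" where
  "W_set G A B =
     {u \<in> carrier G. ({u, inv\<^bsub>G\<^esub> u} <#>\<^bsub>G\<^esub> A <#>\<^bsub>G\<^esub> {u, inv\<^bsub>G\<^esub> u}) \<inter> B = {}}"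

text \<open>
  Maximum of two cardinals. The arguments may live on different types, so the
  larger one is copied into the sum type; the result is a cardinal again, and is
  isomorphic to whichever argument is the larger.
\<close>

definition cmax :: "'a rel \<Rightarrow> 'b rel \<Rightarrow> ('a + 'b) rel" where
  "cmax r s = (if r \<le>o s then |Inr ` Field s| else |Inl ` Field r| )"

lemma cmax_ordIso:
  assumes "Card_order r" "Card_order s"
  shows "r \<le>o s \<Longrightarrow> cmax r s =o s" and "s \<le>o r \<Longrightarrow> cmax r s =o r"
proof -
  have l: "|Inl ` Field r| =o r"
    by (rule ordIso_transitive[OF ordIso_symmetric[OF card_of_ordIsoI[OF inj_on_imp_bij_betw]]
          card_of_Field_ordIso[OF assms(1)]]) simp
  have r: "|Inr ` Field s| =o s"
    by (rule ordIso_transitive[OF ordIso_symmetric[OF card_of_ordIsoI[OF inj_on_imp_bij_betw]]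
          card_of_Field_ordIso[OF assms(2)]]) simp
  show "r \<le>o s \<Longrightarrow> cmax r s =o s"
    using r by (simp add: cmax_def)
  show "s \<le>o r \<Longrightarrow> cmax r s =o r"
    using l r by (auto simp: cmax_def ordIso_iff_ordLeq intro: ordLeq_transitive)
qed

end

theory Submission
  imports Defs
begin

text \<open>
  The condition \<open>XAX \<inter> B = {}\<close> only speaks about pairs of elements of
  \<open>X\<close>. Both halves of the theorem rest on this.

  It is inherited by subsets, so if a symmetric set \<open>X\<close> witnesses separability, then each
  \<open>{x, inv x} \<subseteq> X\<close> satisfies it too, which says \<open>X \<subseteq> W_set G A B\<close>; hence \<open>W_set G A B\<close> is infinite.

  It also passes to unions of chains, so Zorn's lemma gives a maximal symmetric \<open>X\<close> that
  contains \<open>\<one>\<close> and satisfies it; the family is nonempty because \<open>{\<one>}\<close> belongs to it when \<open>A\<close> and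
  \<open>B\<close> are disjoint. Such an \<open>X\<close> cannot be finite when \<open>W_set G A B\<close> is large. To adjoin \<open>u\<close> and
  \<open>inv u\<close> to \<open>X\<close>, the products in which both outer factors are new are harmless as soon as
  \<open>u \<in> W_set G A B\<close>. A product \<open>x a u\<close> or \<open>u a x\<close> with \<open>x \<in> X\<close> equals \<open>b\<close> for one
  \<open>u\<close> only, once \<open>x\<close>, \<open>a\<close> and \<open>b\<close> are given. So at most \<open>max |A| |B| \<aleph>\<^sub>0\<close> elements \<open>u\<close> are
  excluded, and some \<open>u \<in> W_set G A B\<close> outside \<open>X\<close> survives, against maximality
  (\<open>card_obstructed_le\<close> and \<open>extend_avoiding\<close>).
\<close>

lemma Card_order_cmax: "Card_order (cmax r s)"
  by (simp add: cmax_def card_of_Card_order)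

lemma cmax_upper:
  assumes "Card_order r" "Card_order s"
  shows "r \<le>o cmax r s" "s \<le>o cmax r s"
proof -
  have "r \<le>o s \<or> s \<le>o r"
    using assms by (simp add: ordLeq_total card_order_on_well_order_on)
  then show "r \<le>o cmax r s" "s \<le>o cmax r s"
    using cmax_ordIso[OF assms] by (meson ordIso_symmetric ordLeq_ordIso_trans ordIso_imp_ordLeq)+
qed

definition avoiding :: "('a, 'b) monoid_scheme \<Rightarrow> 'a set \<Rightarrow> 'a set \<Rightarrow> 'a set \<Rightarrow> bool" where
  "avoiding G A B X \<longleftrightarrow> (\<forall>x\<in>X. \<forall>y\<in>X. \<forall>a\<in>A. x \<otimes>\<^bsub>G\<^esub> a \<otimes>\<^bsub>G\<^esub> y \<notin> B)"

lemma avoiding_iff: "avoiding G A B X \<longleftrightarrow> (X <#>\<^bsub>G\<^esub> A <#>\<^bsub>G\<^esub> X) \<inter> B = {}"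
  unfolding avoiding_def set_mult_def by blast

definition obstructed :: "('a, 'b) monoid_scheme \<Rightarrow> 'a set \<Rightarrow> 'a set \<Rightarrow> 'a set \<Rightarrow> 'a set" where
  "obstructed G A B X =
     {u \<in> carrier G. \<exists>x\<in>X. \<exists>a\<in>A. x \<otimes>\<^bsub>G\<^esub> a \<otimes>\<^bsub>G\<^esub> u \<in> B \<or> u \<otimes>\<^bsub>G\<^esub> a \<otimes>\<^bsub>G\<^esub> x \<in> B}"

context group
begin

text \<open>
  Each of the equations \<open>x a u = b\<close> and \<open>u a x = b\<close> determines \<open>u\<close> from \<open>(x, a, b)\<close>, so the
  obstructed elements are covered by two images of \<open>X \<times> A \<times> B\<close>.
\<close>

lemma card_obstructed_le:
  assumes "A \<subseteq> carrier G" "B \<subseteq> carrier G" "X \<subseteq> carrier G"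
    and r: "Cinfinite r" and "|A| \<le>o r" "|B| \<le>o r" "|X| \<le>o r"
  shows "|obstructed G A B X| \<le>o r"
proof -
  let ?T = "X \<times> A \<times> B"
  let ?f = "\<lambda>(x, a, b). inv (x \<otimes> a) \<otimes> b" and ?g = "\<lambda>(x, a, b). b \<otimes> inv (a \<otimes> x)"
  have inf: "infinite (Field r)" and co: "Card_order r"
    using r by (auto simp: cinfinite_def)
  have T: "|?T| \<le>o r"
    using inf co assms by (intro card_of_Times_ordLeq_infinite_Field)
  have "obstructed G A B X \<subseteq> ?f ` ?T \<union> ?g ` ?T"
  proof
    fix u assume "u \<in> obstructed G A B X"
    then obtain x a where u: "u \<in> carrier G" "x \<in> X" "a \<in> A"
      and b: "x \<otimes> a \<otimes> u \<in> B \<or> u \<otimes> a \<otimes> x \<in> B"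
      by (auto simp: obstructed_def)
    have c: "x \<in> carrier G" "a \<in> carrier G"
      using u assms by auto
    have "u = ?f (x, a, x \<otimes> a \<otimes> u)"
      using u(1) c by (simp add: inv_solve_left)
    moreover have "u = ?g (x, a, u \<otimes> a \<otimes> x)"
      using u(1) c by (simp add: inv_solve_right m_assoc)
    ultimately show "u \<in> ?f ` ?T \<union> ?g ` ?T"
      using b u by blast
  qed
  moreover have "|?f ` ?T \<union> ?g ` ?T| \<le>o r"
    using inf co T by (intro card_of_Un_ordLeq_infinite_Field ordLeq_transitive[OF card_of_image])
  ultimately show ?thesis
    by (meson card_of_mono1 ordLeq_transitive)
qed

lemma extend_avoiding:
  assumes X: "X \<subseteq> carrier G" "avoiding G A B X"
    and u: "u \<in> W_set G A B" "u \<notin> obstructed G A B X" "inv u \<notin> obstructed G A B X"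
  shows "avoiding G A B (X \<union> {u, inv u})"
proof -
  have "u \<in> carrier G" and W: "avoiding G A B {u, inv u}"
    using u(1) by (auto simp: W_set_def avoiding_iff)
  then have "x \<otimes> a \<otimes> v \<notin> B \<and> v \<otimes> a \<otimes> x \<notin> B"
    if "x \<in> X" "a \<in> A" "v \<in> {u, inv u}" for x a v
    using that u(2,3) by (auto simp: obstructed_def)
  then show ?thesis
    using X(2) W unfolding avoiding_def by blast
qed

lemma avoiding_subset_W_set:
  assumes "X \<subseteq> carrier G" "\<forall>x\<in>X. inv x \<in> X" "avoiding G A B X"
  shows "X \<subseteq> W_set G A B"
proof
  fix x assume "x \<in> X"
  then have "avoiding G A B {x, inv x}" "x \<in> carrier G"
    using assms by (auto simp: avoiding_def)
  then show "x \<in> W_set G A B"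
    by (simp add: W_set_def avoiding_iff)
qed

lemma exists_maximal_avoiding:
  assumes "A \<subseteq> carrier G" "A \<inter> B = {}"
  obtains X where "X \<subseteq> carrier G" "\<one> \<in> X" "\<forall>x\<in>X. inv x \<in> X" "avoiding G A B X"
    "\<And>Y. \<lbrakk>Y \<subseteq> carrier G; \<forall>y\<in>Y. inv y \<in> Y; avoiding G A B Y; X \<subseteq> Y\<rbrakk> \<Longrightarrow> Y = X"
proof -
  define F where
    "F = {X. X \<subseteq> carrier G \<and> \<one> \<in> X \<and> (\<forall>x\<in>X. inv x \<in> X) \<and> avoiding G A B X}"
  have "\<one> \<otimes> a \<otimes> \<one> \<notin> B" if "a \<in> A" for a
    using that assms by (subst r_one; force)
  then have "{\<one>} \<in> F"
    by (auto simp: F_def avoiding_def)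
  then have "F \<noteq> {}"
    by blast
  moreover have "\<Union>C \<in> F" if "C \<noteq> {}" "subset.chain F C" for C
  proof -
    have CF: "C \<subseteq> F" and total: "\<forall>X\<in>C. \<forall>Y\<in>C. X \<subseteq> Y \<or> Y \<subseteq> X"
      using that(2) by (auto simp: subset_chain_def)
    \<comment> \<open>Any two elements of the union already lie in a common member of the chain.\<close>
    have "avoiding G A B (\<Union>C)"
      unfolding avoiding_def
    proof (intro ballI)
      fix x y a assume "x \<in> \<Union>C" "y \<in> \<Union>C" "a \<in> A"
      then obtain Z where "Z \<in> C" "x \<in> Z" "y \<in> Z"
        using total by blast
      then show "x \<otimes> a \<otimes> y \<notin> B"
        using CF \<open>a \<in> A\<close> by (auto simp: F_def avoiding_def)
    qed
    moreover have "\<Union>C \<subseteq> carrier G" "\<one> \<in> \<Union>C" "\<forall>x\<in>\<Union>C. inv x \<in> \<Union>C"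
      using CF that(1) by (auto simp: F_def)
    ultimately show ?thesis
      by (simp add: F_def)
  qed
  ultimately obtain X where X: "X \<in> F" "\<forall>Y\<in>F. X \<subseteq> Y \<longrightarrow> Y = X"
    using subset_Zorn_nonempty[of F] by blast
  show thesis
    by (rule that[of X]) (use X in \<open>auto simp: F_def\<close>)
qed

text \<open>
  If the maximal set \<open>X\<close> were finite, the only elements of \<open>W_set G A B\<close> that could fail to enlarge
  it would be those of \<open>X\<close>, the obstructed ones, and those with an obstructed inverse. These are
  three sets of size at most \<open>r\<close>, so they do not exhaust \<open>W_set G A B\<close>.
\<close>

lemma separable_if_large_W_set:
  assumes A: "A \<subseteq> carrier G" and B: "B \<subseteq> carrier G" and disj: "A \<inter> B = {}"
    and r: "Cinfinite r" "|A| \<le>o r" "|B| \<le>o r" and W: "r <o |W_set G A B|"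
  shows "separable G A B"
proof -
  obtain X where X: "X \<subseteq> carrier G" "\<one> \<in> X" "\<forall>x\<in>X. inv x \<in> X" "avoiding G A B X"
    and max: "\<And>Y. \<lbrakk>Y \<subseteq> carrier G; \<forall>y\<in>Y. inv y \<in> Y; avoiding G A B Y; X \<subseteq> Y\<rbrakk> \<Longrightarrow> Y = X"
    using exists_maximal_avoiding[OF A disj] by metis
  have "infinite X"
  proof
    assume "finite X"
    let ?O = "obstructed G A B X"
    have inf: "infinite (Field r)" and co: "Card_order r"
      using r by (auto simp: cinfinite_def)
    have Xr: "|X| \<le>o r"
      using \<open>finite X\<close> inf co by (metis card_of_Field_ordIso card_of_ordLeq_infinite card_of_ordLeq
          card_of_Well_order ordLeq_ordIso_trans ordLeq_total)
    have O: "|?O| \<le>o r"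
      using card_obstructed_le A B X(1) r Xr by blast
    have "|X \<union> (?O \<union> m_inv G ` ?O)| \<le>o r"
      using inf co Xr O
      by (intro card_of_Un_ordLeq_infinite_Field ordLeq_transitive[OF card_of_image])
    then have "\<not> W_set G A B \<subseteq> X \<union> (?O \<union> m_inv G ` ?O)"
      using W by (meson card_of_mono1 not_ordLess_ordLeq ordLeq_transitive)
    then obtain u where u: "u \<in> W_set G A B" "u \<notin> X" "u \<notin> ?O" "u \<notin> m_inv G ` ?O"
      by blast
    have uG: "u \<in> carrier G"
      using u(1) by (simp add: W_set_def)
    have "inv u \<notin> ?O"
      using u(4) uG by (metis imageI inv_inv)
    then have "avoiding G A B (X \<union> {u, inv u})"
      using extend_avoiding X u by blast
    then have "X \<union> {u, inv u} = X"
      using X uG by (intro max) auto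
    with u(2) show False
      by blast
  qed
  then show ?thesis
    using X by (auto simp: separable_def avoiding_iff)
qed

end

theorem theorem1p1:
  fixes G :: "('a, 'b) monoid_scheme" and A B :: "'a set"
  assumes "group G" and "infinite (carrier G)"
    and "A \<subseteq> carrier G" and "B \<subseteq> carrier G" and "A \<inter> B = {}"
  shows "(cmax (cmax |A| |B| ) natLeq <o |W_set G A B| \<longrightarrow> separable G A B) \<and>
         (finite (W_set G A B) \<longrightarrow> \<not> separable G A B)"
proof (intro conjI impI)
  interpret group G by fact
  let ?r = "cmax (cmax |A| |B| ) natLeq"
  note upper = cmax_upper[OF Card_order_cmax natLeq_Card_order, of "|A|" "|B|"]
  have "Cinfinite ?r"
    using cinfinite_mono[OF upper(2) natLeq_cinfinite] Card_order_cmax by blast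
  moreover have "|A| \<le>o ?r" "|B| \<le>o ?r"
    using cmax_upper[OF card_of_Card_order card_of_Card_order] upper(1)
    by (blast intro: ordLeq_transitive)+
  moreover assume "?r <o |W_set G A B|"
  ultimately show "separable G A B"
    using separable_if_large_W_set assms by blast
next
  interpret group G by fact
  assume "finite (W_set G A B)"
  then show "\<not> separable G A B"
    unfolding separable_def avoiding_iff[symmetric]
    by (meson avoiding_subset_W_set finite_subset)
qed

end
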